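(* Let $G$ be a non-abelian weakly balanced finite group, written as a semidirect product $G = P \ltimes Q$ where $P$ is a $2$-group and $Q$ is a normal abelian subgroup of odd order. Then exactly one of the following is true: (1) $G = P \times Q$ is a direct product (i.e. $P$ acts trivially on $Q$ by conjugation), where $Q$ is non-trivial; (2) $G = P \ltimes Q$ is a sign semidirect product; (3) $G = P$ is a non-abelian $2$-group.
   Context: For a subset $A$ of a group, $AA^{-1} = \{ab^{-1} : a,b \in A\}$ and $A^{-1}A = \{a^{-1}b : a,b\in A\}$. A finite group $G$ is weakly balanced if $|AA^{-1}| = |A^{-1}A|$ for every set $A = H \cup gH$ where $H \le G$ is a non-normal subgroup and $g \in G \setminus N_G(H)$ (with $N_G(H)$ the normalizer of $H$ in $G$). $G = P \ltimes Q$ means that $P$ and $Q$ are subgroups of $G$, $Q$ is normal, $P\cap Q = 1$ and $PQ = G$. Every weakly balanced group admits such a decomposition with $P$ a $2$-group and $Q$ abelian of odd order. Let $\Phi : P \to \mathrm{Aut}(Q)$ be the conjugation action, $\Phi_x(y) = xyx^{-1}$. $G = P \ltimes Q$ is called a sign semidirect product if $Q$ is non-trivial and the image of $\Phi$ is equal to $\{\pm 1\}$, where $1$ is the identity automorphism of $Q$ and $-1$ is the inversion automorphism $y \mapsto y^{-1}$. *)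

theory Defs
  imports "HOL-Algebra.Algebra"
begin

text \<open>Finiteness of the ambient group is not part of this predicate; it has to be assumed
  wherever the predicate is used.\<close>

definition weakly_balanced :: "('a, 'b) monoid_scheme \<Rightarrow> bool" where
  "weakly_balanced G \<longleftrightarrow>
     (\<forall>H g. subgroup H G \<longrightarrow> \<not> H \<lhd> G \<longrightarrow> g \<in> carrier G - normalizer G H \<longrightarrow>
        (let A = H \<union> (g <#\<^bsub>G\<^esub> H) in
           card (A <#>\<^bsub>G\<^esub> (set_inv\<^bsub>G\<^esub> A)) = card ((set_inv\<^bsub>G\<^esub> A) <#>\<^bsub>G\<^esub> A)))"

definition two_group :: "('a, 'b) monoid_scheme \<Rightarrow> bool" where
  "two_group G \<longleftrightarrow> group G \<and> (\<exists>n::nat. order G = 2 ^ n)"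

definition semidirect :: "('a, 'b) monoid_scheme \<Rightarrow> 'a set \<Rightarrow> 'a set \<Rightarrow> bool" where
  "semidirect G P Q \<longleftrightarrow>
     subgroup P G \<and> Q \<lhd> G \<and> P \<inter> Q = {\<one>\<^bsub>G\<^esub>} \<and> P <#>\<^bsub>G\<^esub> Q = carrier G"

text \<open>Maps from \<open>Q\<close> to \<open>Q\<close> are represented as in \<^const>\<open>auto\<close>: they are
  restricted to \<open>Q\<close>, so that equality of functions is equality on \<open>Q\<close>.\<close>

definition conj_action :: "('a, 'b) monoid_scheme \<Rightarrow> 'a set \<Rightarrow> 'a \<Rightarrow> 'a \<Rightarrow> 'a" where
  "conj_action G Q x = (\<lambda>y\<in>Q. x \<otimes>\<^bsub>G\<^esub> y \<otimes>\<^bsub>G\<^esub> inv\<^bsub>G\<^esub> x)"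

definition direct_prod :: "('a, 'b) monoid_scheme \<Rightarrow> 'a set \<Rightarrow> 'a set \<Rightarrow> bool" where
  "direct_prod G P Q \<longleftrightarrow> semidirect G P Q \<and> (\<forall>x\<in>P. conj_action G Q x = (\<lambda>y\<in>Q. y))"

definition sign_semidirect :: "('a, 'b) monoid_scheme \<Rightarrow> 'a set \<Rightarrow> 'a set \<Rightarrow> bool" where
  "sign_semidirect G P Q \<longleftrightarrow>
     semidirect G P Q \<and> Q \<noteq> {\<one>\<^bsub>G\<^esub>} \<and>
     conj_action G Q ` P = {(\<lambda>y\<in>Q. y), (\<lambda>y\<in>Q. inv\<^bsub>G\<^esub> y)}"

definition exactly_one_of_three :: "bool \<Rightarrow> bool \<Rightarrow> bool \<Rightarrow> bool" where
  "exactly_one_of_three A B C \<longleftrightarrow>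
     (A \<and> \<not> B \<and> \<not> C) \<or> (\<not> A \<and> B \<and> \<not> C) \<or> (\<not> A \<and> \<not> B \<and> C)"

end

theory Submission
  imports Defs
begin

text \<open>Everything rests on testing the balance condition on the single family \<open>A = P \<union> qP\<close> with
  \<open>q \<in> Q\<close>. Here \<open>A\<^sup>-\<^sup>1A = P \<union> PqP \<union> Pq\<^sup>-\<^sup>1P\<close>. Since \<open>Q\<close> is normal, \<open>PqP\<close> is the union of the
  left cosets \<open>rP\<close>, where \<open>r\<close> runs through the \<open>P\<close>-conjugates of \<open>q\<close>, and elements of \<open>Q\<close>
  represent pairwise different left cosets of \<open>P\<close>. On the other side,
  \<open>AA\<^sup>-\<^sup>1 = P \<union> qP \<union> Pq\<^sup>-\<^sup>1 \<union> qPq\<^sup>-\<^sup>1\<close> has fewer than \<open>4|P|\<close> elements, because the first and the last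
  set both contain the identity. If some conjugate \<open>r\<close> of \<open>q\<close> were different from \<open>q\<close> and \<open>q\<^sup>-\<^sup>1\<close>,
  then \<open>P\<close>, \<open>qP\<close>, \<open>q\<^sup>-\<^sup>1P\<close>, \<open>rP\<close> would be four different cosets inside \<open>A\<^sup>-\<^sup>1A\<close> (\<open>q \<noteq> q\<^sup>-\<^sup>1\<close> because
  \<open>|Q|\<close> is odd), and the two cardinalities would disagree. So every \<open>x \<in> P\<close> fixes or inverts each
  single \<open>q \<in> Q\<close>; this is \<open>weakly_balanced_fixed_or_inverted\<close>.

  The choice between fixing and inverting cannot depend on \<open>q\<close>: as \<open>Q\<close> is abelian, the elements
  fixed by \<open>x\<close> and the elements inverted by \<open>x\<close> form two subgroups that cover \<open>Q\<close>, and a group is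
  not the union of two proper subgroups; this is \<open>pointwise_sign_imp_global_sign\<close>. Hence \<open>\<Phi>\<close> takes
  values in \<open>{1, -1}\<close>. If \<open>Q\<close> is trivial, \<open>G = P\<close>. Otherwise \<open>1 \<noteq> -1\<close> on \<open>Q\<close>, again because \<open>|Q|\<close> is
  odd, and the image of \<open>\<Phi>\<close> is either \<open>{1}\<close> or \<open>{1, -1}\<close>.\<close>

lemma (in group) odd_subgroup_no_involution:
  assumes "subgroup K G" "odd (order (G\<lparr>carrier := K\<rparr>))" "y \<in> K" "inv y = y"
  shows "y = \<one>"
proof -
  interpret K: group "G\<lparr>carrier := K\<rparr>"
    using assms(1) by (rule subgroup_imp_group)
  have y: "y \<in> carrier G"
    using assms(1,3) by (rule subgroup.mem_carrier)
  obtain k where k: "order (G\<lparr>carrier := K\<rparr>) = Suc (2 * k)"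
    using assms(2) by (auto elim: oddE)
  have "y \<otimes> y = \<one>"
    using assms(4) y r_inv by metis
  then have sq: "y [^] (2::nat) = \<one>"
    using y by (simp add: numeral_2_eq_2)
  have "y [^] order (G\<lparr>carrier := K\<rparr>) = \<one>"
    using K.pow_order_eq_1[of y] assms(3) by (simp flip: nat_pow_consistent)
  moreover have "y [^] (2 * k) = \<one>"
    using nat_pow_pow[OF y, of 2 k] sq by simp
  ultimately show "y = \<one>"
    using k y by simp
qed

text \<open>Products \<open>ap\<close> with distinct \<open>a \<in> Q\<close> thus lie in distinct left cosets of \<open>P\<close>; this is the form in
  which cosets of \<open>P\<close> get counted below.\<close>

lemma (in group) inj_on_mult_complement:
  assumes "subgroup P G" "subgroup Q G" "P \<inter> Q = {\<one>}"
  shows "inj_on (\<lambda>(a, p). a \<otimes> p) (Q \<times> P)"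
proof (rule inj_onI, clarsimp)
  fix a p b r
  assume ab: "a \<in> Q" "b \<in> Q" and pr: "p \<in> P" "r \<in> P" and eq: "a \<otimes> p = b \<otimes> r"
  have c [simp]: "a \<in> carrier G" "b \<in> carrier G" "p \<in> carrier G" "r \<in> carrier G"
    using ab pr assms(1,2) by (auto dest: subgroup.mem_carrier)
  have "inv b \<otimes> a = inv b \<otimes> (a \<otimes> p) \<otimes> inv p"
    by (simp add: m_assoc)
  also have "\<dots> = r \<otimes> inv p"
    by (simp add: eq flip: m_assoc)
  finally have e: "inv b \<otimes> a = r \<otimes> inv p" .
  have "inv b \<otimes> a \<in> Q" "r \<otimes> inv p \<in> P"
    using ab pr assms(1,2) by (auto intro: subgroup.m_closed subgroup.m_inv_closed)
  with e assms(3) have "inv b \<otimes> a = \<one>" by auto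
  then have "a = b"
    by (metis c(1,2) inv_closed inv_equality inv_inv)
  with eq show "a = b \<and> p = r" by simp
qed

text \<open>The commutator of \<open>q\<close> and \<open>x\<close> lies in \<open>P\<close> because \<open>q\<close> normalizes \<open>P\<close>, and in \<open>Q\<close> because \<open>Q\<close> is
  normal. In contrapositive form this supplies the elements outside the normalizer of \<open>P\<close> to which
  weak balance applies.\<close>

lemma (in group) normalizing_complement_commutes:
  assumes P: "subgroup P G" and Q: "Q \<lhd> G" and PQ: "P \<inter> Q = {\<one>}"
    and q: "q \<in> Q" "q \<in> normalizer G P" and x: "x \<in> P"
  shows "x \<otimes> q \<otimes> inv x = q"
proof -
  interpret Q: normal Q G by fact
  have c [simp]: "q \<in> carrier G" "x \<in> carrier G"
    using q(1) x P by (auto dest: subgroup.mem_carrier)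
  have "q <# P #> inv q = P"
    using q(2) subgroup.subset[OF P] by (simp add: normalizer_def stabilizer_def)
  then have "q \<otimes> x \<otimes> inv q \<in> P"
    using x unfolding l_coset_def r_coset_def by blast
  then have "q \<otimes> x \<otimes> inv q \<otimes> inv x \<in> P"
    using x P by (simp add: subgroup.m_closed subgroup.m_inv_closed)
  moreover have "q \<otimes> (x \<otimes> inv q \<otimes> inv x) \<in> Q"
    using q(1) by (simp add: Q.inv_op_closed2)
  ultimately have "q \<otimes> (x \<otimes> inv q \<otimes> inv x) = \<one>"
    using PQ by (auto simp: m_assoc)
  then have "inv (x \<otimes> inv q \<otimes> inv x) = q"
    by (simp add: inv_equality)
  then show ?thesis
    by (simp add: inv_mult_group m_assoc)
qed

text \<open>A \<open>P\<close>-conjugate \<open>r\<close> of \<open>q\<close> other than \<open>q\<close> and \<open>q\<^sup>-\<^sup>1\<close> would give \<open>|A\<^sup>-\<^sup>1A| \<ge> 4|P| > |AA\<^sup>-\<^sup>1|\<close> for \<open>A = P \<union> qP\<close>: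
  the coset \<open>rP\<close> lies in \<open>PqP\<close>, while \<open>P\<close> and \<open>qPq\<^sup>-\<^sup>1\<close> overlap in \<open>\<one>\<close>.\<close>

lemma (in group) weakly_balanced_fixed_or_inverted:
  assumes fin: "finite (carrier G)" and wb: "weakly_balanced G"
    and P: "subgroup P G" and Q: "Q \<lhd> G" and PQ: "P \<inter> Q = {\<one>}"
    and odd: "odd (order (G\<lparr>carrier := Q\<rparr>))" and x: "x \<in> P" and q: "q \<in> Q"
  shows "x \<otimes> q \<otimes> inv x = q \<or> x \<otimes> q \<otimes> inv x = inv q"
proof (rule ccontr)
  interpret Q: normal Q G by fact
  define r where "r = x \<otimes> q \<otimes> inv x"
  assume "\<not> ?thesis"
  then have r: "r \<noteq> q" "r \<noteq> inv q" by (auto simp: r_def)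
  have c [simp]: "q \<in> carrier G" "x \<in> carrier G"
    using q x P by (auto dest: subgroup.mem_carrier)
  have Pc [simp]: "p \<in> carrier G" if "p \<in> P" for p
    using that P by (auto dest: subgroup.mem_carrier)
  have rQ: "r \<in> Q" unfolding r_def by (simp add: Q.inv_op_closed2 q)
  have finP: "finite P"
    using P fin finite_subset subgroup.subset by blast
  have oneP: "\<one> \<in> P" using P by (rule subgroup.one_closed)
  have q1: "q \<noteq> \<one>" using r by (auto simp: r_def)
  have qinv: "inv q \<noteq> q"
    using odd_subgroup_no_involution[OF Q.is_subgroup odd q] q1 by auto
  have qinv1: "inv q \<noteq> \<one>" using q1 by simp
  have r1: "r \<noteq> \<one>"
  proof
    assume "r = \<one>"
    then have "x \<otimes> q = x" unfolding r_def using inv_equality by fastforce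
    then show False using q1 by simp
  qed
  have nq: "q \<notin> normalizer G P"
    using normalizing_complement_commutes[OF P Q PQ q _ x] r by (auto simp: r_def)
  have nP: "\<not> P \<lhd> G"
  proof
    assume "P \<lhd> G"
    then interpret P: normal P G .
    have "q <# P #> inv q = P"
      using P.coset_eq[THEN bspec, of q, symmetric] P.subset by (simp add: coset_mult_assoc)
    then show False
      using nq P.subset by (simp add: normalizer_def stabilizer_def)
  qed
  define A where "A = P \<union> (q <# P)"
  have bal: "card (A <#> set_inv A) = card (set_inv A <#> A)"
    using wb nP nq P unfolding weakly_balanced_def A_def Let_def by auto
  have invP: "inv p \<in> P" if "p \<in> P" for p
    using that P by (rule subgroup.m_inv_closed[rotated])
  have mP: "p \<otimes> s \<in> P" if "p \<in> P" "s \<in> P" for p s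
    using that P by (auto intro: subgroup.m_closed)
  have Ac: "A \<subseteq> carrier G" unfolding A_def l_coset_def by auto
  have inA: "p \<in> A" "q \<otimes> p \<in> A" if "p \<in> P" for p
    using that unfolding A_def l_coset_def by auto
  have inA': "p \<in> set_inv A" "p \<otimes> inv q \<in> set_inv A" if "p \<in> P" for p
  proof -
    have "inv (inv p) \<in> set_inv A" "inv (q \<otimes> inv p) \<in> set_inv A"
      using inA[OF invP[OF that]] unfolding SET_INV_def by blast+
    then show "p \<in> set_inv A" "p \<otimes> inv q \<in> set_inv A"
      using that by (simp_all add: inv_mult_group)
  qed
  \<comment> \<open>\<open>A\<^sup>-\<^sup>1A\<close> contains four different left cosets of \<open>P\<close>; the fourth is \<open>rP = xqP\<close> with \<open>x \<in> P \<subseteq> A\<^sup>-\<^sup>1\<close>.\<close>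
  have "(\<lambda>(a, p). a \<otimes> p) ` ({\<one>, q, inv q, r} \<times> P) \<subseteq> set_inv A <#> A"
  proof clarify
    fix a p assume a: "a \<in> {\<one>, q, inv q, r}" and p: "p \<in> P"
    have mem: "u \<otimes> v \<in> set_inv A <#> A" if "u \<in> set_inv A" "v \<in> A" for u v
      using that unfolding set_mult_def by auto
    have "r \<otimes> p = x \<otimes> (q \<otimes> (inv x \<otimes> p))"
      using p by (simp add: r_def m_assoc)
    moreover have "inv q \<otimes> p = \<one> \<otimes> inv q \<otimes> p"
      by simp
    ultimately show "a \<otimes> p \<in> set_inv A <#> A"
      using a mem[OF inA'(1)[OF oneP] inA(1)[OF p]] mem[OF inA'(1)[OF oneP] inA(2)[OF p]]
        mem[OF inA'(2)[OF oneP] inA(1)[OF p]]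
        mem[OF inA'(1)[OF x] inA(2)[OF mP[OF invP[OF x] p]]] p
      by auto
  qed
  moreover have finA: "finite A" using Ac fin finite_subset by blast
  moreover have "finite (set_inv A <#> A)"
    using finA unfolding set_mult_def SET_INV_def by auto
  moreover have "inj_on (\<lambda>(a, p). a \<otimes> p) ({\<one>, q, inv q, r} \<times> P)"
    by (rule inj_on_subset[OF inj_on_mult_complement[OF P Q.is_subgroup PQ]]) (use q rQ in auto)
  moreover have "card ({\<one>, q, inv q, r} \<times> P) = 4 * card P"
    using q1[symmetric] r[symmetric] r1[symmetric] qinv[symmetric] qinv1[symmetric]
    by (simp add: card_cartesian_product)
  ultimately have lower: "4 * card P \<le> card (set_inv A <#> A)"
    by (metis card_image card_mono)
  \<comment> \<open>\<open>AA\<^sup>-\<^sup>1\<close> is covered by four sets of size at most \<open>|P|\<close>. Dropping \<open>\<one>\<close> from the parameters of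
    \<open>qPq\<^sup>-\<^sup>1\<close> makes the bound strict: its value \<open>qq\<^sup>-\<^sup>1\<close> already lies in \<open>P\<close>.\<close>
  define S where "S = (P \<union> (\<lambda>p. q \<otimes> p) ` P) \<union> ((\<lambda>p. p \<otimes> inv q) ` P \<union> (\<lambda>p. q \<otimes> p \<otimes> inv q) ` (P - {\<one>}))"
  have "A <#> set_inv A \<subseteq> S"
  proof
    fix z assume "z \<in> A <#> set_inv A"
    then obtain a b where ab: "a \<in> A" "b \<in> A" "z = a \<otimes> inv b"
      unfolding set_mult_def SET_INV_def by auto
    obtain p s where p: "p \<in> P" "s \<in> P" and "a = p \<or> a = q \<otimes> p" "b = s \<or> b = q \<otimes> s"
      using ab unfolding A_def l_coset_def by auto
    moreover define t where "t = p \<otimes> inv s"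
    ultimately have z: "z = t \<or> z = q \<otimes> t \<or> z = t \<otimes> inv q \<or> z = q \<otimes> t \<otimes> inv q"
      using ab(3) by (auto simp: inv_mult_group m_assoc)
    have t: "t \<in> P" using p by (simp add: t_def mP invP)
    show "z \<in> S"
    proof (cases "z = q \<otimes> t \<otimes> inv q \<and> t = \<one>")
      case True
      then have "z = \<one>" by simp
      then show ?thesis using oneP by (simp add: S_def)
    next
      case False
      then show ?thesis using z t unfolding S_def by blast
    qed
  qed
  moreover have "finite S" unfolding S_def using finP by simp
  ultimately have "card (A <#> set_inv A) \<le> card S" by (rule card_mono[rotated])
  also have "card S \<le> (card P + card P) + (card P + card (P - {\<one>}))"
    unfolding S_def
    by (intro order.trans[OF card_Un_le] add_mono card_image_le order.refl finP finite_Diff)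
  also have "\<dots> < 4 * card P"
    using card_Diff1_less[OF finP oneP] by simp
  finally show False using lower bal by simp
qed

lemma (in group) conj_mult_distrib:
  assumes "x \<in> carrier G" "a \<in> carrier G" "b \<in> carrier G"
  shows "x \<otimes> (a \<otimes> b) \<otimes> inv x = (x \<otimes> a \<otimes> inv x) \<otimes> (x \<otimes> b \<otimes> inv x)"
proof -
  have "x \<otimes> a \<otimes> inv x \<otimes> (x \<otimes> b \<otimes> inv x) = x \<otimes> a \<otimes> (inv x \<otimes> x) \<otimes> b \<otimes> inv x"
    using assms by (simp only: m_assoc inv_closed m_closed)
  then show ?thesis using assms by (simp add: m_assoc)
qed

text \<open>The argument that no group is the union of two proper subgroups: if \<open>x\<close> inverts but does not fix
  \<open>a\<close>, and fixes but does not invert \<open>b\<close>, then it can neither fix nor invert \<open>ab\<close>. Commutativity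
  enters when \<open>(ab)\<^sup>-\<^sup>1\<close> is expanded.\<close>

lemma (in group) pointwise_sign_imp_global_sign:
  assumes Q: "subgroup Q G" and comm: "comm_group (G\<lparr>carrier := Q\<rparr>)" and x: "x \<in> carrier G"
    and sign: "\<And>q. q \<in> Q \<Longrightarrow> x \<otimes> q \<otimes> inv x = q \<or> x \<otimes> q \<otimes> inv x = inv q"
  shows "(\<forall>q\<in>Q. x \<otimes> q \<otimes> inv x = q) \<or> (\<forall>q\<in>Q. x \<otimes> q \<otimes> inv x = inv q)"
proof (rule ccontr)
  assume "\<not> ?thesis"
  then obtain a b where a: "a \<in> Q" "x \<otimes> a \<otimes> inv x \<noteq> a" and b: "b \<in> Q" "x \<otimes> b \<otimes> inv x \<noteq> inv b"
    by blast
  have xa: "x \<otimes> a \<otimes> inv x = inv a" and xb: "x \<otimes> b \<otimes> inv x = b"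
    using sign a b by auto
  have c [simp]: "a \<in> carrier G" "b \<in> carrier G"
    using Q a b by (auto dest: subgroup.mem_carrier)
  have xab: "x \<otimes> (a \<otimes> b) \<otimes> inv x = inv a \<otimes> b"
    using conj_mult_distrib[OF x c] xa xb by simp
  have "a \<otimes> b \<in> Q" using Q a b by (auto intro: subgroup.m_closed)
  then consider "inv a \<otimes> b = a \<otimes> b" | "inv a \<otimes> b = inv (a \<otimes> b)"
    using sign[of "a \<otimes> b"] xab by auto
  then show False
  proof cases
    case 1
    then show ?thesis using a xa by simp
  next
    case 2
    have "inv (a \<otimes> b) = inv (b \<otimes> a)"
      using comm_monoid.m_comm[OF comm_group.axioms(1)[OF comm], of a b] a(1) b(1) by simp
    then have "b = inv b" using 2 by (simp add: inv_mult_group)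
    then show ?thesis using b xb by simp
  qed
qed

theorem corollary3p7:
  fixes G :: "('a, 'b) monoid_scheme" and P Q :: "'a set"
  assumes "group G" and "finite (carrier G)"
    and "\<not> comm_group G"
    and "weakly_balanced G"
    and "semidirect G P Q"
    and "two_group (G\<lparr>carrier := P\<rparr>)"
    and "comm_group (G\<lparr>carrier := Q\<rparr>)"
    and "odd (order (G\<lparr>carrier := Q\<rparr>))"
  shows "exactly_one_of_three
           (direct_prod G P Q \<and> Q \<noteq> {\<one>\<^bsub>G\<^esub>})
           (sign_semidirect G P Q)
           (carrier G = P \<and> two_group (G\<lparr>carrier := P\<rparr>) \<and> \<not> comm_group (G\<lparr>carrier := P\<rparr>))"
proof -
  interpret group G by fact
  have P: "subgroup P G" and Q: "Q \<lhd> G" and PQ: "P \<inter> Q = {\<one>\<^bsub>G\<^esub>}" and gen: "P <#>\<^bsub>G\<^esub> Q = carrier G"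
    using assms(5) by (auto simp: semidirect_def)
  interpret Q: normal Q G by fact
  let ?id = "\<lambda>y\<in>Q. y" and ?neg = "\<lambda>y\<in>Q. inv\<^bsub>G\<^esub> y"
  have trivial_iff: "carrier G = P \<longleftrightarrow> Q = {\<one>\<^bsub>G\<^esub>}"
  proof
    assume "carrier G = P"
    then show "Q = {\<one>\<^bsub>G\<^esub>}" using PQ Q.subset by auto
  next
    assume "Q = {\<one>\<^bsub>G\<^esub>}"
    then have "P <#>\<^bsub>G\<^esub> Q = P"
      using subgroup.subset[OF P] by (force simp: set_mult_def)
    then show "carrier G = P" using gen by simp
  qed
  have neg_ne_id: "?neg \<noteq> ?id" if nontriv: "Q \<noteq> {\<one>\<^bsub>G\<^esub>}"
  proof
    assume eq: "?neg = ?id"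
    have "y = \<one>\<^bsub>G\<^esub>" if "y \<in> Q" for y
      using odd_subgroup_no_involution[OF Q.is_subgroup assms(8) that] fun_cong[OF eq, of y] that
      by simp
    with nontriv Q.one_closed show False by blast
  qed
  have sign: "conj_action G Q x = ?id \<or> conj_action G Q x = ?neg" if "x \<in> P" for x
  proof -
    have "x \<in> carrier G" using P that by (rule subgroup.mem_carrier)
    from pointwise_sign_imp_global_sign[OF Q.is_subgroup assms(7) this
        weakly_balanced_fixed_or_inverted[OF assms(2,4) P Q PQ assms(8) that]]
    show ?thesis unfolding conj_action_def by (auto intro!: restrict_ext)
  qed
  have one: "conj_action G Q \<one>\<^bsub>G\<^esub> = ?id"
    unfolding conj_action_def by (auto intro!: restrict_ext)
  have oneP: "\<one>\<^bsub>G\<^esub> \<in> P" using P by (rule subgroup.one_closed)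
  show ?thesis
  proof (cases "Q = {\<one>\<^bsub>G\<^esub>}")
    case True
    then have "carrier G = P" using trivial_iff by simp
    moreover from this have "G\<lparr>carrier := P\<rparr> = G" by auto
    then have "\<not> comm_group (G\<lparr>carrier := P\<rparr>)" using assms(3) by (rule ssubst)
    ultimately show ?thesis
      using True assms(6) by (simp add: exactly_one_of_three_def sign_semidirect_def)
  next
    case False
    have "sign_semidirect G P Q \<longleftrightarrow> \<not> direct_prod G P Q"
    proof
      assume "sign_semidirect G P Q"
      then have "?neg \<in> conj_action G Q ` P" by (simp add: sign_semidirect_def)
      then show "\<not> direct_prod G P Q"
        using neg_ne_id[OF False] by (auto simp: direct_prod_def)
    next
      assume "\<not> direct_prod G P Q"
      then obtain x where "x \<in> P" "conj_action G Q x \<noteq> ?id"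
        using assms(5) by (auto simp: direct_prod_def)
      then have "?neg \<in> conj_action G Q ` P" using sign[of x] by (metis image_eqI)
      moreover have "?id \<in> conj_action G Q ` P" using one oneP by (metis image_eqI)
      ultimately have "conj_action G Q ` P = {?id, ?neg}" using sign by blast
      then show "sign_semidirect G P Q"
        using assms(5) False by (simp add: sign_semidirect_def)
    qed
    then show ?thesis
      using False trivial_iff by (auto simp: exactly_one_of_three_def)
  qed
qed

end
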